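(* Let $G$ be a group and let $W$ be a nonempty subset of $G$. Then the following statements are equivalent. (1) $W$ admits a minimal complement in $G$. (2) For every subgroup $H$ of $G$ containing $W$, the set $W$ admits a minimal complement in $H$. (3) For some subgroup $H$ of $G$ containing $W$, the set $W$ admits a minimal complement in $H$.
   Context: For a group $K$ and nonempty subsets $W, W' \subseteq K$, $W'$ is called a complement of $W$ in $K$ if $WW' = \{ww' : w \in W, w' \in W'\} = K$. A complement $W'$ of $W$ in $K$ is called a minimal complement of $W$ in $K$ if no proper subset of $W'$ is a complement of $W$ in $K$, i.e. $W(W' \setminus \{w'\}) \neq K$ for every $w' \in W'$. *)

theory Defs
  imports "HOL-Algebra.Coset"
begin

definition is_complement :: "('a, 'b) monoid_scheme \<Rightarrow> 'a set \<Rightarrow> 'a set \<Rightarrow> bool" where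
  "is_complement K W W' \<longleftrightarrow>
     W \<noteq> {} \<and> W \<subseteq> carrier K \<and> W' \<noteq> {} \<and> W' \<subseteq> carrier K \<and> W <#>\<^bsub>K\<^esub> W' = carrier K"

definition is_minimal_complement :: "('a, 'b) monoid_scheme \<Rightarrow> 'a set \<Rightarrow> 'a set \<Rightarrow> bool" where
  "is_minimal_complement K W W' \<longleftrightarrow>
     is_complement K W W' \<and> (\<forall>V. V \<subset> W' \<longrightarrow> \<not> is_complement K W V)"

definition admits_minimal_complement :: "('a, 'b) monoid_scheme \<Rightarrow> 'a set \<Rightarrow> bool" where
  "admits_minimal_complement K W \<longleftrightarrow> (\<exists>W'. is_minimal_complement K W W')"

end

theory Submission
  imports Defs
begin

text \<open>For \<open>W \<subseteq> H\<close>, left multiplication by elements of \<open>W\<close> preserves each right coset of \<open>H\<close>.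
  So being a complement of \<open>W\<close> in \<open>G\<close> is a condition on each right coset separately, and right
  translation identifies the condition on any right coset with the one on \<open>H\<close> itself.
  Intersecting with \<open>H\<close> goes from \<open>G\<close> to \<open>H\<close>; putting one translate of the minimal complement
  into every right coset goes from \<open>H\<close> to \<open>G\<close>.\<close>

context group
begin

text \<open>Products of elements of \<open>W\<close> and \<open>V\<close> stay in the carrier, so
  only covering is at stake, and covering the identity already forces \<open>V\<close> to be
  nonempty.\<close>

lemma is_complement_iff:
  assumes "W \<subseteq> carrier G" "W \<noteq> {}"
  shows "is_complement G W V \<longleftrightarrow>
    V \<subseteq> carrier G \<and> (\<forall>g\<in>carrier G. \<exists>w\<in>W. \<exists>v\<in>V. g = w \<otimes> v)"
proof -
  have "W <#> V \<subseteq> carrier G" if "V \<subseteq> carrier G"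
    by (rule set_mult_closed[OF assms(1) that])
  moreover have "carrier G \<subseteq> W <#> V \<longleftrightarrow> (\<forall>g\<in>carrier G. \<exists>w\<in>W. \<exists>v\<in>V. g = w \<otimes> v)"
    unfolding set_mult_def by (simp add: subset_iff Ball_def)
  moreover have "V \<noteq> {}" if "\<forall>g\<in>carrier G. \<exists>w\<in>W. \<exists>v\<in>V. g = w \<otimes> v"
    using that one_closed by blast
  ultimately show ?thesis
    using assms unfolding is_complement_def by (metis subset_antisym order_refl)
qed

lemma is_complement_subgroup_iff:
  assumes "subgroup H G" "W \<subseteq> H" "W \<noteq> {}"
  shows "is_complement (G\<lparr>carrier := H\<rparr>) W V \<longleftrightarrow>
    V \<subseteq> H \<and> (\<forall>h\<in>H. \<exists>w\<in>W. \<exists>v\<in>V. h = w \<otimes> v)"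
  using group.is_complement_iff[OF subgroup_imp_group[OF assms(1)], of W V] assms(2,3) by simp

text \<open>Minimality survives because a smaller complement inside \<open>H\<close> could be glued
  to the part of \<open>V\<close> outside \<open>H\<close>, which would shrink \<open>V\<close>
  itself.\<close>

lemma minimal_complement_restrict:
  assumes H: "subgroup H G" and W: "W \<subseteq> H" "W \<noteq> {}"
    and V: "is_minimal_complement G W V"
  shows "is_minimal_complement (G\<lparr>carrier := H\<rparr>) W (V \<inter> H)"
proof -
  have HG: "H \<subseteq> carrier G" by (rule subgroup.subset[OF H])
  with W have WG: "W \<subseteq> carrier G" by blast
  note cG = is_complement_iff[OF WG W(2)]
  note cH = is_complement_subgroup_iff[OF H W]
  from V have VG: "V \<subseteq> carrier G" and cov: "\<And>g. g \<in> carrier G \<Longrightarrow> \<exists>w\<in>W. \<exists>v\<in>V. g = w \<otimes> v"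
    and min: "\<And>U. U \<subset> V \<Longrightarrow> \<not> is_complement G W U"
    unfolding is_minimal_complement_def cG by blast+
  \<comment> \<open>Hence elements of \<open>H\<close> are covered only through
    \<open>V \<inter> H\<close>, and all others only through \<open>V - H\<close>.\<close>
  have in_H: "w \<otimes> v \<in> H \<longleftrightarrow> v \<in> H" if "w \<in> W" "v \<in> V" for w v
  proof
    assume "w \<otimes> v \<in> H"
    then have "inv w \<otimes> (w \<otimes> v) \<in> H"
      using that W(1) H by (blast intro: subgroup.m_closed subgroup.m_inv_closed)
    moreover have "inv w \<otimes> (w \<otimes> v) = v"
      using that WG VG by (simp add: m_assoc[symmetric] subset_iff)
    ultimately show "v \<in> H" by simp
  next
    assume "v \<in> H"
    then show "w \<otimes> v \<in> H" using that W(1) H by (blast intro: subgroup.m_closed)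
  qed
  show ?thesis
    unfolding is_minimal_complement_def
  proof (intro conjI allI impI notI)
    show "is_complement (G\<lparr>carrier := H\<rparr>) W (V \<inter> H)"
      unfolding cH
    proof (intro conjI ballI)
      show "V \<inter> H \<subseteq> H" by blast
      fix h assume h: "h \<in> H"
      with HG cov obtain w v where wv: "w \<in> W" "v \<in> V" "h = w \<otimes> v" by blast
      with h in_H[OF wv(1,2)] show "\<exists>w\<in>W. \<exists>v\<in>V \<inter> H. h = w \<otimes> v" by blast
    qed
  next
    fix U assume "U \<subset> V \<inter> H" and "is_complement (G\<lparr>carrier := H\<rparr>) W U"
    then have U: "\<And>h. h \<in> H \<Longrightarrow> \<exists>w\<in>W. \<exists>u\<in>U. h = w \<otimes> u" unfolding cH by blast
    \<comment> \<open>Replacing \<open>V \<inter> H\<close> by \<open>U\<close> leaves the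
      factorizations of elements outside \<open>H\<close> untouched.\<close>
    have "is_complement G W (U \<union> (V - H))"
      unfolding cG
    proof (intro conjI ballI)
      show "U \<union> (V - H) \<subseteq> carrier G" using \<open>U \<subset> V \<inter> H\<close> VG by blast
      fix g assume "g \<in> carrier G"
      then obtain w v where wv: "w \<in> W" "v \<in> V" "g = w \<otimes> v" using cov by blast
      show "\<exists>w\<in>W. \<exists>v\<in>U \<union> (V - H). g = w \<otimes> v"
      proof (cases "g \<in> H")
        case True
        then show ?thesis using U by blast
      next
        case False
        with wv in_H[OF wv(1,2)] show ?thesis by blast
      qed
    qed
    moreover have "U \<union> (V - H) \<subset> V" using \<open>U \<subset> V \<inter> H\<close> by blast
    ultimately show False using min by blast
  qed
qed

text \<open>If an element could be dropped from the assembled set, then translating its coset back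
  to \<open>H\<close> would give a complement strictly inside the minimal one.\<close>

lemma admits_minimal_complement_extend:
  assumes H: "subgroup H G" and W: "W \<subseteq> H" "W \<noteq> {}"
    and "admits_minimal_complement (G\<lparr>carrier := H\<rparr>) W"
  shows "admits_minimal_complement G W"
proof -
  have HG: "H \<subseteq> carrier G" by (rule subgroup.subset[OF H])
  with W have WG: "W \<subseteq> carrier G" by blast
  note cG = is_complement_iff[OF WG W(2)]
  note cH = is_complement_subgroup_iff[OF H W]
  from assms(4) obtain V where V: "is_minimal_complement (G\<lparr>carrier := H\<rparr>) W V"
    unfolding admits_minimal_complement_def by blast
  then have VH: "V \<subseteq> H" and cov: "\<And>h. h \<in> H \<Longrightarrow> \<exists>w\<in>W. \<exists>v\<in>V. h = w \<otimes> v"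
    and min: "\<And>U. U \<subset> V \<Longrightarrow> \<not> is_complement (G\<lparr>carrier := H\<rparr>) W U"
    unfolding is_minimal_complement_def cH by blast+
  \<comment> \<open>The choice sees only the coset \<open>H #> g\<close>, so \<open>rep\<close> is
    constant on each right coset.\<close>
  define rep where "rep g = (SOME x. x \<in> H #> g)" for g
  have rep_coset: "rep g \<in> H #> g" if "g \<in> carrier G" for g
    unfolding rep_def by (rule someI) (rule rcos_self[OF that H])
  have rep_closed: "rep g \<in> carrier G" if "g \<in> carrier G" for g
    using rep_coset[OF that] r_coset_subset_G[OF HG that] by blast
  have rep_mult: "rep (h \<otimes> rep g) = rep g" if "h \<in> H" "g \<in> carrier G" for h g
  proof -
    have "h \<otimes> rep g \<in> H #> rep g"
      using that(1) HG rep_closed[OF that(2)] by (blast intro: rcosI)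
    then have "H #> (h \<otimes> rep g) = H #> g"
      using repr_independence[OF _ _ H] rep_coset rep_closed that(2) by metis
    then show ?thesis by (simp add: rep_def)
  qed
  \<comment> \<open>Writing \<open>g = h \<otimes> rep g\<close>, the factor \<open>h\<close> is the
    coordinate of \<open>g\<close> in \<open>H\<close>.\<close>
  have rep_quot: "g \<otimes> inv (rep g) \<in> H" if "g \<in> carrier G" for g
  proof -
    have "H #> g = H #> rep g" by (rule repr_independence[OF rep_coset[OF that] that H])
    then have "g \<in> H #> rep g" using rcos_self[OF that H] by simp
    then show ?thesis
      using subgroup.rcos_module_imp[OF H is_group rep_closed[OF that]] by blast
  qed
  \<comment> \<open>The union of the translates of \<open>V\<close> by all chosen representatives:
    an element belongs when its coordinate in \<open>H\<close> lies in \<open>V\<close>.\<close>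
  define V' where "V' = {g \<in> carrier G. g \<otimes> inv (rep g) \<in> V}"
  have "is_minimal_complement G W V'"
    unfolding is_minimal_complement_def
  proof (intro conjI allI impI notI)
    show "is_complement G W V'"
      unfolding cG
    proof (intro conjI ballI)
      show "V' \<subseteq> carrier G" unfolding V'_def by blast
      fix g assume g: "g \<in> carrier G"
      note r = rep_closed[OF g]
      \<comment> \<open>Factor the coordinate of \<open>g\<close> within \<open>H\<close>, then
        multiply back by \<open>rep g\<close> on the right.\<close>
      obtain w v where wv: "w \<in> W" "v \<in> V" and eq: "g \<otimes> inv (rep g) = w \<otimes> v"
        using cov[OF rep_quot[OF g]] by blast
      have wG: "w \<in> carrier G" and vH: "v \<in> H" and vG: "v \<in> carrier G"
        using wv WG VH HG by auto
      have "g = (w \<otimes> v) \<otimes> rep g"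
        unfolding eq[symmetric] using g r by (simp add: m_assoc)
      then have "g = w \<otimes> (v \<otimes> rep g)" using wG vG r by (simp add: m_assoc)
      moreover have "v \<otimes> rep g \<in> V'"
        unfolding V'_def using rep_mult[OF vH g] vG r wv(2) by (simp add: m_assoc)
      ultimately show "\<exists>w\<in>W. \<exists>v\<in>V'. g = w \<otimes> v" using wv(1) by blast
    qed
  next
    fix U assume UV: "U \<subset> V'" and "is_complement G W U"
    then have U: "\<And>g. g \<in> carrier G \<Longrightarrow> \<exists>w\<in>W. \<exists>u\<in>U. g = w \<otimes> u" unfolding cG by blast
    from UV obtain x where x: "x \<in> V'" "x \<notin> U" by blast
    then have xG: "x \<in> carrier G" and xV: "x \<otimes> inv (rep x) \<in> V" unfolding V'_def by auto
    define r where "r = rep x"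
    have r: "r \<in> carrier G" unfolding r_def by (rule rep_closed[OF xG])
    \<comment> \<open>The slice of \<open>U\<close> in the coset of the missing element
      \<open>x\<close>, translated back to \<open>H\<close>.\<close>
    define U' where "U' = {h \<in> H. h \<otimes> r \<in> U}"
    have "U' \<subseteq> V"
    proof
      fix h assume "h \<in> U'"
      then have h: "h \<in> H" and "h \<otimes> r \<in> V'" using UV unfolding U'_def by auto
      then show "h \<in> V"
        using rep_mult[OF h xG] r HG unfolding V'_def r_def[symmetric]
        by (auto simp: m_assoc subset_iff)
    qed
    \<comment> \<open>The coordinate of \<open>x\<close> lies in \<open>V\<close>, but translating
      it by \<open>r\<close> returns \<open>x\<close>, which \<open>U\<close> misses; so the
      inclusion is strict.\<close>
    moreover have "x \<otimes> inv r \<notin> U'"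
      unfolding U'_def using x(2) xG r by (simp add: m_assoc)
    ultimately have "U' \<subset> V" using xV unfolding r_def by blast
    moreover have "is_complement (G\<lparr>carrier := H\<rparr>) W U'"
      unfolding cH
    proof (intro conjI ballI)
      show "U' \<subseteq> H" unfolding U'_def by blast
      fix h assume h: "h \<in> H"
      then have hG: "h \<in> carrier G" using HG by blast
      obtain w u where wu: "w \<in> W" "u \<in> U" and eq: "h \<otimes> r = w \<otimes> u"
        using U[of "h \<otimes> r"] hG r by blast
      have wG: "w \<in> carrier G" and uG: "u \<in> carrier G"
        using wu WG UV unfolding V'_def by auto
      \<comment> \<open>Solving for \<open>u\<close> shows that it stays in the coset of
        \<open>r\<close>, with coordinate \<open>inv w \<otimes> h\<close>.\<close>
      have "u = inv w \<otimes> (h \<otimes> r)" unfolding eq using wG uG by (simp add: m_assoc[symmetric])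
      then have "(inv w \<otimes> h) \<otimes> r = u" using wG hG r by (simp add: m_assoc)
      moreover have "inv w \<otimes> h \<in> H"
        using wu(1) W(1) h H by (blast intro: subgroup.m_closed subgroup.m_inv_closed)
      ultimately have "inv w \<otimes> h \<in> U'" using wu(2) unfolding U'_def by simp
      moreover have "h = w \<otimes> (inv w \<otimes> h)" using wG hG by (simp add: m_assoc[symmetric])
      ultimately show "\<exists>w\<in>W. \<exists>v\<in>U'. h = w \<otimes> v" using wu(1) by blast
    qed
    ultimately show False using min by blast
  qed
  then show ?thesis unfolding admits_minimal_complement_def by blast
qed

lemma admits_minimal_complement_subgroup_iff:
  assumes "subgroup H G" "W \<subseteq> H" "W \<noteq> {}"
  shows "admits_minimal_complement (G\<lparr>carrier := H\<rparr>) W \<longleftrightarrow> admits_minimal_complement G W"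
  using minimal_complement_restrict[OF assms] admits_minimal_complement_extend[OF assms]
  unfolding admits_minimal_complement_def by blast

end

theorem theorem2p3:
  fixes G :: "('a, 'b) monoid_scheme" and W :: "'a set"
  assumes "group G" and "W \<subseteq> carrier G" and "W \<noteq> {}"
  shows "(admits_minimal_complement G W \<longleftrightarrow>
            (\<forall>H. subgroup H G \<and> W \<subseteq> H \<longrightarrow> admits_minimal_complement (G\<lparr>carrier := H\<rparr>) W))
       \<and> ((\<forall>H. subgroup H G \<and> W \<subseteq> H \<longrightarrow> admits_minimal_complement (G\<lparr>carrier := H\<rparr>) W) \<longleftrightarrow>
            (\<exists>H. subgroup H G \<and> W \<subseteq> H \<and> admits_minimal_complement (G\<lparr>carrier := H\<rparr>) W))"
proof -
  \<comment> \<open>The answer is the same for every \<open>H\<close> as for \<open>G\<close>; the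
    carrier itself witnesses that such an \<open>H\<close> exists, so the universal statement is not
    vacuous.\<close>
  have "subgroup (carrier G) G" by (rule group.subgroup_self[OF assms(1)])
  moreover have "admits_minimal_complement (G\<lparr>carrier := H\<rparr>) W \<longleftrightarrow> admits_minimal_complement G W"
    if "subgroup H G" "W \<subseteq> H" for H
    by (rule group.admits_minimal_complement_subgroup_iff[OF assms(1) that assms(3)])
  ultimately show ?thesis using assms(2) by auto
qed

end
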